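(* Fix $\ell\in\{1,\dots,r\}$, let $\delta_\ell(q)=\min_{k\ne\ell}|\rho_\ell(q)-\rho_k(q)|$, choose $0<d<\delta_\ell(q)$, and let $\Gamma=\Gamma_\ell(d)=\{z\in\mathbb C:|z-\rho_\ell(q)|=d\}$. Suppose that at least one of the following three conditions holds: (1) $\sup_{z\in\Gamma}|\widetilde\Psi_q(z)-\Psi_q(z)|<\min_{z\in\Gamma}|\Psi_q(z)|$; (2) $\sup_{z\in\Gamma}\bigl\|A_q(z)^{-1}(\Delta_{r,1}^{(q)}-z\Delta_{r,0}^{(q)})\bigr\|_2<2^{1/r}-1$; (3) $\|\Delta_{r,1}^{(q)}\|_2+\bigl(\max_{z\in\Gamma}|z|\bigr)\|\Delta_{r,0}^{(q)}\|_2<(2^{1/r}-1)\min_{z\in\Gamma}\sigma_{\min}(A_q(z))$. Then $\widetilde\Psi_q$ has exactly one zero $\widehat\rho_\ell$ (counted with multiplicity) in the disk $|z-\rho_\ell(q)|<d$; thus $|\widehat\rho_\ell-\rho_\ell(q)|<d$. If also $d<|\rho_\ell(q)|$ and $\widehat\alpha_\ell\in\mathbb C$ satisfies $q^{\widehat\alpha_\ell}=\widehat\rho_\ell$, then for some $k\in\mathbb Z$, $$\left|\widehat\alpha_\ell-\alpha_\ell-\frac{2\pi ik}{\log q}\right|\le\frac{d}{|\log q|\bigl(|\rho_\ell(q)|-d\bigr)}.$$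
   Context: Let $r\ge1$, $q\in(0,1)$, $\alpha_1,\dots,\alpha_r\in\mathbb C$, $w_1,\dots,w_r\in\mathbb C\setminus\{0\}$, with nodes $\rho_\ell(q)=q^{\alpha_\ell}=e^{\alpha_\ell\log q}$ assumed pairwise distinct (for $r=1$, $\delta_\ell(q)=+\infty$). Put $\mu_n^{(q)}=\sum_{\ell=1}^r w_\ell\rho_\ell(q)^n$ for $n\ge0$ and $H_{r,s}^{(q)}=(\mu_{i+j+s}^{(q)})_{i,j=0}^{r-1}$ for $s=0,1$. Let $\Delta_{r,0}^{(q)},\Delta_{r,1}^{(q)}\in\mathbb C^{r\times r}$ and $\widetilde H_{r,s}^{(q)}=H_{r,s}^{(q)}+\Delta_{r,s}^{(q)}$. Put $A_q(z)=H_{r,1}^{(q)}-zH_{r,0}^{(q)}$, $\Psi_q(z)=\det A_q(z)$, $\widetilde A_q(z)=\widetilde H_{r,1}^{(q)}-z\widetilde H_{r,0}^{(q)}$, $\widetilde\Psi_q(z)=\det\widetilde A_q(z)$. $\sigma_{\min}$ is the smallest singular value and $\|\cdot\|_2$ the spectral norm. *)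

theory Defs
  imports
    "HOL-Complex_Analysis.Complex_Analysis"
    "Jordan_Normal_Form.Schur_Decomposition"
    "Jordan_Normal_Form.Determinant"
    "Jordan_Normal_Form.Gauss_Jordan_Elimination"
begin

text \<open>Matrices, determinants and eigenvalues are those of the entry Jordan_Normal_Form;
  names shared with HOL-Analysis are therefore qualified.\<close>

unbundle no vec_syntax

definition euclid_norm :: "complex Matrix.vec \<Rightarrow> real" where
  "euclid_norm v = sqrt (\<Sum>i<dim_vec v. (cmod (vec_index v i))\<^sup>2)"

definition spectral_norm :: "complex Matrix.mat \<Rightarrow> real" where
  "spectral_norm A =
     (SUP v \<in> {v \<in> carrier_vec (dim_col A). euclid_norm v = 1}. euclid_norm (A *\<^sub>v v))"

text \<open>Singular values are the nonnegative square roots of the eigenvalues of \<open>A\<^sup>* A\<close>.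
  For a square matrix of positive size this set is finite and nonempty.\<close>

definition singular_values :: "complex Matrix.mat \<Rightarrow> real set" where
  "singular_values A =
     {\<sigma>. \<sigma> \<ge> 0 \<and> eigenvalue (mat_adjoint A * A) (complex_of_real (\<sigma>\<^sup>2))}"

definition sigma_min :: "complex Matrix.mat \<Rightarrow> real" where
  "sigma_min A = Min (singular_values A)"

text \<open>The library inverse is an option; it is \<open>None\<close> exactly for singular square matrices,
  on which the value below is unspecified.\<close>

definition mat_inv :: "complex Matrix.mat \<Rightarrow> complex Matrix.mat" where
  "mat_inv A = the (mat_inverse A)"

text \<open>For real \<open>q > 0\<close>, complex \<open>powr\<close> is \<open>exp (\<alpha> * ln q)\<close> with the real logarithm.
  Nodes and weights are indexed by \<open>1..r\<close>, matrix entries by \<open>0..r-1\<close>.\<close>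

definition node :: "real \<Rightarrow> (nat \<Rightarrow> complex) \<Rightarrow> nat \<Rightarrow> complex" where
  "node q \<alpha> l = complex_of_real q powr \<alpha> l"

definition moment ::
    "nat \<Rightarrow> real \<Rightarrow> (nat \<Rightarrow> complex) \<Rightarrow> (nat \<Rightarrow> complex) \<Rightarrow> nat \<Rightarrow> complex" where
  "moment r q \<alpha> w n = (\<Sum>l=1..r. w l * node q \<alpha> l ^ n)"

definition hankel ::
    "nat \<Rightarrow> real \<Rightarrow> (nat \<Rightarrow> complex) \<Rightarrow> (nat \<Rightarrow> complex) \<Rightarrow> nat \<Rightarrow> complex Matrix.mat" where
  "hankel r q \<alpha> w s = Matrix.mat r r (\<lambda>(i, j). moment r q \<alpha> w (i + j + s))"

definition pencil :: "complex Matrix.mat \<Rightarrow> complex Matrix.mat \<Rightarrow> complex \<Rightarrow> complex Matrix.mat" where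
  "pencil M1 M0 z = M1 - z \<cdot>\<^sub>m M0"

text \<open>Separation of node \<open>l\<close> from the others. It is extended real, so that for \<open>r = 1\<close> the
  infimum over the empty set is \<open>\<infinity>\<close>.\<close>

definition separation :: "nat \<Rightarrow> real \<Rightarrow> (nat \<Rightarrow> complex) \<Rightarrow> nat \<Rightarrow> ereal" where
  "separation r q \<alpha> l = (INF k \<in> {1..r} - {l}. ereal (cmod (node q \<alpha> l - node q \<alpha> k)))"

end

theory Submission
  imports Defs
begin

text \<open>
  On \<open>\<Gamma>\<close> each of the three conditions implies the pointwise Rouche inequality
  \<open>\<bar>\<Psi>' z - \<Psi> z\<bar> < \<bar>\<Psi> z\<bar>\<close>, so \<open>\<Psi>'\<close> has as many zeros in the disk as \<open>\<Psi>\<close>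
  (\<open>Rouche_poly_simple_zero\<close>).  The unperturbed pencil factors as \<open>V\<^sup>T D(z) V\<close> with \<open>V\<close> a
  Vandermonde matrix and \<open>D(z)\<close> diagonal with entries \<open>w k * (\<rho> k - z)\<close>, hence \<open>\<Psi>\<close> is a
  nonzero constant times \<open>\<Prod>k. (\<rho> k - z)\<close> (\<open>det_hankel_pencil\<close>): the separation hypothesis
  leaves exactly one zero in the disk, a simple one, and none on \<open>\<Gamma>\<close>.

  Condition (1) is the Rouche inequality, made uniform.  For the other two write
  \<open>A' = A * (1 + E)\<close> with \<open>E = A\<^sup>-\<^sup>1 * (\<Delta>1 - z \<Delta>0)\<close>, so that the claim reads
  \<open>\<bar>det (1 + E) - 1\<bar> < 1\<close>.  The determinant is the product of the \<open>1 + a\<close> over the eigenvalues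
  \<open>a\<close> of \<open>E\<close>, and if all of these have modulus at most \<open>c\<close>, the difference is at most
  \<open>(1 + c)\<^sup>r - 1\<close>, which is below \<open>1\<close> exactly for \<open>c < 2\<^sup>1\<^sup>/\<^sup>r - 1\<close>
  (\<open>norm_det_perturbation_less\<close>).  Under (2) the spectral norm of \<open>E\<close> is such a \<open>c\<close>.  Under (3)
  an eigenvector \<open>v\<close> of \<open>E\<close> satisfies \<open>(\<Delta>1 - z \<Delta>0) v = a A v\<close>, and \<open>\<parallel>A v\<parallel>\<close> is at least
  \<open>\<sigma>\<^sub>m\<^sub>i\<^sub>n \<parallel>v\<parallel>\<close>; this bounds \<open>\<bar>a\<bar>\<close> directly (\<open>eigenvalue_inverse_mult_sigma_min_le\<close>).

  Real suprema and infima bound their members only when the family is bounded.  On the compact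
  circle this is clear for determinants; for the norm of \<open>E\<close> it comes from Cramer's rule, which
  makes the entries of \<open>A\<^sup>-\<^sup>1\<close> rational in \<open>z\<close>.

  The bound on the exponent compares \<open>q\<^sup>\<alpha>\<^sup>'\<close> with \<open>q\<^sup>\<alpha>\<close> through the principal logarithm of
  their quotient \<open>1 + u\<close>, where \<open>\<bar>u\<bar> < d / \<bar>\<rho>\<bar> < 1\<close> (\<open>exponent_error_bound\<close>).
\<close>

section \<open>The Euclidean norm and the spectral norm\<close>

lemma euclid_norm_eq_L2_set: "euclid_norm v = L2_set (\<lambda>i. cmod (vec_index v i)) {..<dim_vec v}"
  by (simp add: euclid_norm_def L2_set_def)

lemma euclid_norm_nonneg [simp]: "0 \<le> euclid_norm v"
  by (simp add: euclid_norm_eq_L2_set)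

lemma euclid_norm_eq_0_iff:
  assumes "v \<in> carrier_vec n"
  shows "euclid_norm v = 0 \<longleftrightarrow> v = 0\<^sub>v n"
  using assms by (auto simp: euclid_norm_eq_L2_set L2_set_eq_0_iff)

lemma euclid_norm_smult: "euclid_norm (c \<cdot>\<^sub>v v) = cmod c * euclid_norm v"
  by (simp add: euclid_norm_eq_L2_set norm_mult L2_set_right_distrib cong: L2_set_cong_simp)

lemma euclid_norm_triangle:
  assumes "v \<in> carrier_vec n" "u \<in> carrier_vec n"
  shows "euclid_norm (v + u) \<le> euclid_norm v + euclid_norm u"
proof -
  have "euclid_norm (v + u) \<le> L2_set (\<lambda>i. cmod (vec_index v i) + cmod (vec_index u i)) {..<n}"
    unfolding euclid_norm_eq_L2_set using assms
    by (auto intro!: L2_set_mono norm_triangle_ineq)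
  also have "\<dots> \<le> euclid_norm v + euclid_norm u"
    using assms L2_set_triangle_ineq[of "\<lambda>i. cmod (vec_index v i)" "\<lambda>i. cmod (vec_index u i)" "{..<n}"]
    by (simp add: euclid_norm_eq_L2_set)
  finally show ?thesis .
qed

text \<open>A crude operator bound.  It serves to show that the supremum defining the spectral norm is
  taken over a bounded set, and it is visibly continuous in the entries.\<close>

lemma euclid_norm_mult_le_entries:
  assumes A: "A \<in> carrier_mat n m" and v: "v \<in> carrier_vec m"
  shows "euclid_norm (A *\<^sub>v v) \<le> (\<Sum>i<n. \<Sum>j<m. cmod (A $$ (i,j))) * euclid_norm v"
proof -
  have "euclid_norm (A *\<^sub>v v) \<le> (\<Sum>i<n. cmod (vec_index (A *\<^sub>v v) i))"
    unfolding euclid_norm_eq_L2_set using A by (intro order_trans[OF L2_set_le_sum]) auto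
  also have "\<dots> \<le> (\<Sum>i<n. (\<Sum>j<m. cmod (A $$ (i,j))) * euclid_norm v)"
  proof (rule sum_mono)
    fix i assume i: "i \<in> {..<n}"
    have "cmod (vec_index (A *\<^sub>v v) i) = cmod (\<Sum>j<m. A $$ (i,j) * vec_index v j)"
      using A v i by (simp add: scalar_prod_def atLeast0LessThan)
    also have "\<dots> \<le> (\<Sum>j<m. cmod (A $$ (i,j)) * euclid_norm v)"
    proof (rule sum_norm_le)
      fix j assume j: "j \<in> {..<m}"
      then have "cmod (vec_index v j) \<le> euclid_norm v"
        unfolding euclid_norm_eq_L2_set using v by (intro member_le_L2_set) auto
      then show "cmod (A $$ (i,j) * vec_index v j) \<le> cmod (A $$ (i,j)) * euclid_norm v"
        by (simp add: norm_mult mult_left_mono)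
    qed
    finally show "cmod (vec_index (A *\<^sub>v v) i) \<le> (\<Sum>j<m. cmod (A $$ (i,j))) * euclid_norm v"
      by (simp add: sum_distrib_right)
  qed
  finally show ?thesis by (simp add: sum_distrib_right)
qed

lemma unit_sphere_nonempty:
  assumes "0 < n"
  shows "{v \<in> carrier_vec n. euclid_norm v = 1} \<noteq> {}"
proof -
  have "(\<Sum>i<n. (cmod (vec_index (unit_vec n 0) i))\<^sup>2) = (\<Sum>i\<in>{0::nat}. 1)"
    using assms by (intro sum.mono_neutral_cong_right) (auto simp: unit_vec_def)
  then have "euclid_norm (unit_vec n 0) = 1"
    by (simp add: euclid_norm_def)
  then show ?thesis by (auto intro!: exI[of _ "unit_vec n 0"])
qed

lemma spectral_norm_le_entries:
  assumes A: "A \<in> carrier_mat n m" and m: "0 < m"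
  shows "spectral_norm A \<le> (\<Sum>i<n. \<Sum>j<m. cmod (A $$ (i,j)))"
  unfolding spectral_norm_def
proof (rule cSUP_least)
  show "{v \<in> carrier_vec (dim_col A). euclid_norm v = 1} \<noteq> {}"
    using unit_sphere_nonempty[OF m] A by simp
next
  fix v assume "v \<in> {v \<in> carrier_vec (dim_col A). euclid_norm v = 1}"
  then show "euclid_norm (A *\<^sub>v v) \<le> (\<Sum>i<n. \<Sum>j<m. cmod (A $$ (i,j)))"
    using euclid_norm_mult_le_entries[OF A, of v] A by auto
qed

lemma euclid_norm_mult_le:
  assumes A: "A \<in> carrier_mat n m" and v: "v \<in> carrier_vec m"
  shows "euclid_norm (A *\<^sub>v v) \<le> spectral_norm A * euclid_norm v"
proof (cases "euclid_norm v = 0")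
  case True
  then show ?thesis using euclid_norm_mult_le_entries[OF A v] by simp
next
  case False
  define c where "c = complex_of_real (1 / euclid_norm v)"
  have nc: "cmod c = 1 / euclid_norm v"
    unfolding c_def norm_of_real by simp
  have "euclid_norm (A *\<^sub>v (c \<cdot>\<^sub>v v)) \<le> spectral_norm A"
    unfolding spectral_norm_def
  proof (rule cSUP_upper)
    show "c \<cdot>\<^sub>v v \<in> {v \<in> carrier_vec (dim_col A). euclid_norm v = 1}"
      using A v False nc by (simp add: euclid_norm_smult)
    show "bdd_above ((\<lambda>v. euclid_norm (A *\<^sub>v v)) ` {v \<in> carrier_vec (dim_col A). euclid_norm v = 1})"
      using euclid_norm_mult_le_entries[OF A] A
      by (intro bdd_aboveI2[where M = "\<Sum>i<n. \<Sum>j<m. cmod (A $$ (i,j))"]) fastforce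
  qed
  also have "A *\<^sub>v (c \<cdot>\<^sub>v v) = c \<cdot>\<^sub>v (A *\<^sub>v v)"
    using A v by (rule mult_mat_vec)
  finally show ?thesis
    using False nc by (simp add: euclid_norm_smult field_simps less_le)
qed

lemma spectral_norm_nonneg:
  assumes A: "A \<in> carrier_mat n m" and m: "0 < m"
  shows "0 \<le> spectral_norm A"
proof -
  obtain v where "v \<in> carrier_vec m" "euclid_norm v = 1"
    using unit_sphere_nonempty[OF m] by blast
  then show ?thesis
    using euclid_norm_mult_le[OF A, of v] euclid_norm_nonneg[of "A *\<^sub>v v"]
    by (metis mult.right_neutral order_trans)
qed

lemma eigenvalue_norm_le_spectral_norm:
  assumes A: "A \<in> carrier_mat n n" and "eigenvalue A a"
  shows "cmod a \<le> spectral_norm A"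
proof -
  obtain v where v: "v \<in> carrier_vec n" "v \<noteq> 0\<^sub>v n" "A *\<^sub>v v = a \<cdot>\<^sub>v v"
    using assms by (auto simp: eigenvalue_def eigenvector_def)
  have "cmod a * euclid_norm v \<le> spectral_norm A * euclid_norm v"
    using euclid_norm_mult_le[OF A v(1)] v(3) by (simp add: euclid_norm_smult)
  moreover have "euclid_norm v \<noteq> 0"
    using v euclid_norm_eq_0_iff by blast
  ultimately show ?thesis
    using euclid_norm_nonneg[of v] by (metis less_le mult_le_cancel_right_pos)
qed

section \<open>Inverses and scalar multiples of matrices\<close>

lemma smult_mat_mult_vec:
  assumes "A \<in> carrier_mat n m" "v \<in> carrier_vec m"
  shows "(c \<cdot>\<^sub>m A) *\<^sub>v v = c \<cdot>\<^sub>v (A *\<^sub>v v)"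
  using assms by (intro eq_vecI) (auto simp: scalar_prod_def sum_distrib_left mult.assoc)

lemma inverse_mat_exists:
  fixes A :: "complex Matrix.mat"
  assumes A: "A \<in> carrier_mat n n" and d: "Determinant.det A \<noteq> 0"
  obtains C where "C \<in> carrier_mat n n" "A * C = 1\<^sub>m n" "C * A = 1\<^sub>m n" "mat_inverse A = Some C"
proof (cases "mat_inverse A")
  case None
  from mat_inverse(1)[OF A None, of "()"] have "A \<notin> Units (ring_mat TYPE(complex) n ())" .
  with det_non_zero_imp_unit[OF A d, of "()"] show ?thesis by simp
next
  case (Some C)
  from mat_inverse(2)[OF A Some] that Some show ?thesis by blast
qed

lemma mat_inv_inverse:
  assumes A: "A \<in> carrier_mat n n" and d: "Determinant.det A \<noteq> 0"
  shows "mat_inv A \<in> carrier_mat n n" "A * mat_inv A = 1\<^sub>m n" "mat_inv A * A = 1\<^sub>m n"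
  using inverse_mat_exists[OF A d] unfolding mat_inv_def by (metis option.sel)+

lemma det_smult_mat_inv:
  assumes A: "A \<in> carrier_mat n n" and d: "Determinant.det A \<noteq> 0"
  shows "Determinant.det A \<cdot>\<^sub>m mat_inv A = adj_mat A"
proof -
  note inv = mat_inv_inverse[OF A d] and adj = adj_mat[OF A]
  have "adj_mat A = (mat_inv A * A) * adj_mat A" using inv adj by simp
  also have "\<dots> = mat_inv A * (A * adj_mat A)"
    using inv(1) A adj(1) by (rule assoc_mult_mat)
  also have "\<dots> = Determinant.det A \<cdot>\<^sub>m mat_inv A"
    unfolding adj(2) using inv(1) by (simp add: mult_smult_distrib[of _ n n _ n])
  finally show ?thesis ..
qed

section \<open>The smallest singular value\<close>

lemma euclid_norm_sq: "(euclid_norm v)\<^sup>2 = (\<Sum>i<dim_vec v. (cmod (vec_index v i))\<^sup>2)"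
  by (simp add: euclid_norm_def sum_nonneg)

lemma Re_cscalar_prod_self: "Re (v \<bullet>c v) = (euclid_norm v)\<^sup>2"
  unfolding euclid_norm_sq cmod_power2
  by (simp add: scalar_prod_def atLeast0LessThan power2_eq_square)

lemma euclid_norm_sq_add_smult:
  assumes "v \<in> carrier_vec n" "u \<in> carrier_vec n"
  shows "(euclid_norm (v + complex_of_real t \<cdot>\<^sub>v u))\<^sup>2
       = (euclid_norm v)\<^sup>2 + 2 * t * Re (v \<bullet>c u) + t\<^sup>2 * (euclid_norm u)\<^sup>2"
proof -
  have *: "(cmod (a + complex_of_real t * b))\<^sup>2
      = (cmod a)\<^sup>2 + 2 * t * Re (a * cnj b) + t\<^sup>2 * (cmod b)\<^sup>2" for a b
    unfolding cmod_power2 by (simp add: power2_eq_square algebra_simps)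
  show ?thesis
    using assms
    by (simp add: euclid_norm_sq scalar_prod_def atLeast0LessThan * sum.distrib sum_distrib_left distrib_left)
qed

lemma mat_adjoint_carrier:
  fixes A :: "complex Matrix.mat"
  assumes "A \<in> carrier_mat n m"
  shows "mat_adjoint A \<in> carrier_mat m n"
  using assms by (simp add: mat_adjoint_def mat_of_rows_def)

lemma index_mat_adjoint:
  fixes A :: "complex Matrix.mat"
  assumes "A \<in> carrier_mat n m" "i < m" "j < n"
  shows "mat_adjoint A $$ (i,j) = cnj (A $$ (j,i))"
  using assms by (simp add: mat_adjoint_def mat_of_rows_def)

lemma cscalar_prod_mult_mat_vec:
  fixes A :: "complex Matrix.mat"
  assumes A: "A \<in> carrier_mat n m" and v: "v \<in> carrier_vec m" and u: "u \<in> carrier_vec n"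
  shows "u \<bullet>c (A *\<^sub>v v) = (mat_adjoint A *\<^sub>v u) \<bullet>c v"
proof -
  have "u \<bullet>c (A *\<^sub>v v) = (\<Sum>i<n. \<Sum>j<m. vec_index u i * cnj (A $$ (i,j)) * cnj (vec_index v j))"
    using A u v by (simp add: scalar_prod_def atLeast0LessThan sum_distrib_left mult_ac)
  also have "\<dots> = (\<Sum>j<m. \<Sum>i<n. vec_index u i * cnj (A $$ (i,j)) * cnj (vec_index v j))"
    by (rule sum.swap)
  also have "\<dots> = (mat_adjoint A *\<^sub>v u) \<bullet>c v"
    using A u v mat_adjoint_carrier[OF A]
    by (simp add: scalar_prod_def atLeast0LessThan sum_distrib_left sum_distrib_right
        index_mat_adjoint[OF A] mult_ac)
  finally show ?thesis .
qed

text \<open>Let \<open>m\<close> be the infimum of \<open>\<parallel>A v\<parallel>\<^sup>2\<close> over unit vectors, so that \<open>B = A\<^sup>* A - m\<close> is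
  positive semidefinite.  If \<open>B\<close> were invertible, \<open>\<parallel>B v\<parallel>\<close> would stay away from \<open>0\<close> on unit vectors;
  moving \<open>v\<close> a short way in the direction \<open>- B v\<close> lowers the quadratic form of \<open>B\<close> by a multiple
  of \<open>\<parallel>B v\<parallel>\<^sup>2\<close>, so the form would be bounded away from \<open>0\<close> and the infimum could be raised.
  Hence \<open>m\<close> is an eigenvalue of \<open>A\<^sup>* A\<close>.\<close>

lemma least_rayleigh_quotient_is_eigenvalue:
  assumes A: "A \<in> carrier_mat n n" and n: "0 < n"
  obtains m where "0 \<le> m" "eigenvalue (mat_adjoint A * A) (complex_of_real m)"
    "\<And>v. v \<in> carrier_vec n \<Longrightarrow> m * (euclid_norm v)\<^sup>2 \<le> (euclid_norm (A *\<^sub>v v))\<^sup>2"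
proof -
  define S where "S = {v \<in> carrier_vec n. euclid_norm v = 1}"
  define m where "m = (INF v\<in>S. (euclid_norm (A *\<^sub>v v))\<^sup>2)"
  have S: "S \<noteq> {}" unfolding S_def by (rule unit_sphere_nonempty[OF n])
  have m0: "0 \<le> m" unfolding m_def by (rule cINF_greatest[OF S]) simp
  have bdd: "bdd_below ((\<lambda>v. (euclid_norm (A *\<^sub>v v))\<^sup>2) ` S)"
    by (rule bdd_belowI2[of _ 0]) simp
  have ray: "m * (euclid_norm v)\<^sup>2 \<le> (euclid_norm (A *\<^sub>v v))\<^sup>2" if v: "v \<in> carrier_vec n" for v
  proof (cases "euclid_norm v = 0")
    case False
    define c where "c = complex_of_real (1 / euclid_norm v)"
    have nc: "cmod c = 1 / euclid_norm v"
      unfolding c_def norm_of_real by simp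
    have "c \<cdot>\<^sub>v v \<in> S" using v False nc by (simp add: S_def euclid_norm_smult)
    then have "m \<le> (euclid_norm (A *\<^sub>v (c \<cdot>\<^sub>v v)))\<^sup>2"
      unfolding m_def by (rule cINF_lower[OF bdd])
    also have "A *\<^sub>v (c \<cdot>\<^sub>v v) = c \<cdot>\<^sub>v (A *\<^sub>v v)" using A v by (rule mult_mat_vec)
    finally show ?thesis
      using False by (simp add: euclid_norm_smult nc power_divide pos_le_divide_eq)
  qed simp
  let ?H = "mat_adjoint A * A"
  have H: "?H \<in> carrier_mat n n" by (rule mult_carrier_mat[OF mat_adjoint_carrier[OF A] A])
  define B where "B = char_matrix ?H (complex_of_real m)"
  have B: "B \<in> carrier_mat n n" unfolding B_def using H by simp
  have "eigenvalue ?H (complex_of_real m)"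
  proof (rule ccontr)
    assume "\<not> eigenvalue ?H (complex_of_real m)"
    then have "Determinant.det B \<noteq> 0" using eigenvalue_det[OF H] unfolding B_def by simp
    then obtain C where C: "C \<in> carrier_mat n n" "C * B = 1\<^sub>m n"
      using inverse_mat_exists[OF B] by metis
    define K where "K = (\<Sum>i<n. \<Sum>j<n. cmod (A $$ (i,j)))"
    define L where "L = (\<Sum>i<n. \<Sum>j<n. cmod (C $$ (i,j))) + 1"
    define b where "b = K\<^sup>2 + 1"
    have b: "0 < b" unfolding b_def by (simp add: add_nonneg_pos)
    have L: "0 < L" unfolding L_def by (intro add_nonneg_pos sum_nonneg) auto
    have lower: "m + 1 / (b * L\<^sup>2) \<le> (euclid_norm (A *\<^sub>v v))\<^sup>2" if vS: "v \<in> S" for v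
    proof -
      have v: "v \<in> carrier_vec n" and v1: "euclid_norm v = 1" using vS by (auto simp: S_def)
      define u where "u = B *\<^sub>v v"
      have u: "u \<in> carrier_vec n" unfolding u_def using B v by simp
      (* As b bounds the form of B, this step against the gradient u lowers it by at least
         (euclid_norm u)^2 / b. *)
      define t where "t = - 1 / b"
      let ?t = "complex_of_real t"
      have Av: "A *\<^sub>v v \<in> carrier_vec n" and Au: "A *\<^sub>v u \<in> carrier_vec n" using A u v by auto
      have Hv: "?H *\<^sub>v v = mat_adjoint A *\<^sub>v (A *\<^sub>v v)"
        using mat_adjoint_carrier[OF A] A v by (rule assoc_mult_mat_vec)
      have Hvc: "?H *\<^sub>v v \<in> carrier_vec n" using H v by (rule mult_mat_vec_carrier)
      have "u = ?H *\<^sub>v v + (- complex_of_real m) \<cdot>\<^sub>v v"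
        unfolding u_def B_def char_matrix_def carrier_matD(1)[OF H]
        using v by (subst add_mult_distrib_mat_vec[OF H]) (auto simp: smult_mat_mult_vec[of _ n n])
      then have "u \<bullet>c u = (?H *\<^sub>v v) \<bullet>c u + - complex_of_real m * (v \<bullet>c u)"
        using Hvc u v by (metis add_scalar_prod_distrib carrier_vec_conjugate smult_carrier_vec
            smult_scalar_prod_distrib)
      also have "(?H *\<^sub>v v) \<bullet>c u = (A *\<^sub>v v) \<bullet>c (A *\<^sub>v u)"
        unfolding Hv by (rule cscalar_prod_mult_mat_vec[OF A u Av, symmetric])
      finally have uu: "(euclid_norm u)\<^sup>2 = Re ((A *\<^sub>v v) \<bullet>c (A *\<^sub>v u)) - m * Re (v \<bullet>c u)"
        by (simp flip: Re_cscalar_prod_self)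
      have "A *\<^sub>v (v + ?t \<cdot>\<^sub>v u) = A *\<^sub>v v + ?t \<cdot>\<^sub>v (A *\<^sub>v u)"
        using A u v by (simp add: mult_add_distrib_mat_vec[of _ n n] mult_mat_vec)
      with ray[of "v + ?t \<cdot>\<^sub>v u"] u v
      have "m * ((euclid_norm v)\<^sup>2 + 2 * t * Re (v \<bullet>c u) + t\<^sup>2 * (euclid_norm u)\<^sup>2)
          \<le> (euclid_norm (A *\<^sub>v v))\<^sup>2 + 2 * t * Re ((A *\<^sub>v v) \<bullet>c (A *\<^sub>v u)) + t\<^sup>2 * (euclid_norm (A *\<^sub>v u))\<^sup>2"
        by (simp add: euclid_norm_sq_add_smult[OF v u] euclid_norm_sq_add_smult[OF Av Au])
      then have "m + m * t\<^sup>2 * (euclid_norm u)\<^sup>2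
          \<le> (euclid_norm (A *\<^sub>v v))\<^sup>2 + 2 * t * (euclid_norm u)\<^sup>2 + t\<^sup>2 * (euclid_norm (A *\<^sub>v u))\<^sup>2"
        unfolding v1 uu by (simp add: algebra_simps)
      moreover have "t\<^sup>2 * (euclid_norm (A *\<^sub>v u))\<^sup>2 \<le> t\<^sup>2 * (b * (euclid_norm u)\<^sup>2)"
      proof (rule mult_left_mono)
        have "(euclid_norm (A *\<^sub>v u))\<^sup>2 \<le> (K * euclid_norm u)\<^sup>2"
          using euclid_norm_mult_le_entries[OF A u] unfolding K_def by (intro power_mono) auto
        also have "\<dots> \<le> b * (euclid_norm u)\<^sup>2"
          unfolding b_def power_mult_distrib by (intro mult_right_mono) auto
        finally show "(euclid_norm (A *\<^sub>v u))\<^sup>2 \<le> b * (euclid_norm u)\<^sup>2" .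
      qed simp
      moreover have "t\<^sup>2 * (b * (euclid_norm u)\<^sup>2) = - t * (euclid_norm u)\<^sup>2"
        unfolding t_def using b by (simp add: power2_eq_square)
      moreover have "0 \<le> m * t\<^sup>2 * (euclid_norm u)\<^sup>2" using m0 by simp
      ultimately have "m + (euclid_norm u)\<^sup>2 / b \<le> (euclid_norm (A *\<^sub>v v))\<^sup>2"
        unfolding t_def by simp
      moreover have "1 / L \<le> euclid_norm u"
      proof -
        have "v = C *\<^sub>v u" unfolding u_def using C B v
          by (metis assoc_mult_mat_vec one_mult_mat_vec)
        then have "1 \<le> (L - 1) * euclid_norm u"
          using euclid_norm_mult_le_entries[OF C(1) u] v1 unfolding L_def by simp
        then have "1 + euclid_norm u \<le> L * euclid_norm u" by (simp add: algebra_simps)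
        then have "1 \<le> L * euclid_norm u" using euclid_norm_nonneg[of u] by linarith
        then show ?thesis using L by (simp add: field_simps)
      qed
      then have "(1 / L)\<^sup>2 / b \<le> (euclid_norm u)\<^sup>2 / b"
        using b L by (intro divide_right_mono power_mono) auto
      ultimately show ?thesis by (simp add: power_divide mult.commute)
    qed
    have "m + 1 / (b * L\<^sup>2) \<le> m"
      using lower by (subst (2) m_def) (rule cINF_greatest[OF S])
    then show False using b L by (simp add: field_simps)
  qed
  with m0 ray that show ?thesis by blast
qed

lemma finite_singular_values:
  assumes A: "A \<in> carrier_mat n n"
  shows "finite (singular_values A)"
proof -
  let ?H = "mat_adjoint A * A"
  have H: "?H \<in> carrier_mat n n" by (rule mult_carrier_mat[OF mat_adjoint_carrier[OF A] A])
  have "finite {k. poly (char_poly ?H) k = 0}"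
    using degree_monic_char_poly[OF H] by (intro poly_roots_finite) auto
  then have "finite ((\<lambda>k. sqrt (Re k)) ` {k. eigenvalue ?H k})"
    using eigenvalue_root_char_poly[OF H] by simp
  moreover have "singular_values A \<subseteq> (\<lambda>k. sqrt (Re k)) ` {k. eigenvalue ?H k}"
    unfolding singular_values_def by (auto intro!: rev_image_eqI)
  ultimately show ?thesis by (rule finite_subset[rotated])
qed

text \<open>The square root of the least Rayleigh quotient is a singular value, so \<open>sigma_min\<close>, as a
  minimum over singular values, is well defined and does not exceed it.\<close>

lemma
  assumes A: "A \<in> carrier_mat n n" and n: "0 < n"
  shows sigma_min_nonneg: "0 \<le> sigma_min A"
    and sigma_min_mult_le: "v \<in> carrier_vec n \<Longrightarrow> sigma_min A * euclid_norm v \<le> euclid_norm (A *\<^sub>v v)"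
proof -
  obtain m where m: "0 \<le> m" "eigenvalue (mat_adjoint A * A) (complex_of_real m)"
    "\<And>v. v \<in> carrier_vec n \<Longrightarrow> m * (euclid_norm v)\<^sup>2 \<le> (euclid_norm (A *\<^sub>v v))\<^sup>2"
    using least_rayleigh_quotient_is_eigenvalue[OF A n] by metis
  have mem: "sqrt m \<in> singular_values A" using m by (simp add: singular_values_def flip: of_real_power)
  then have "sigma_min A \<in> singular_values A"
    unfolding sigma_min_def using finite_singular_values[OF A] by (intro Min_in) auto
  then show "0 \<le> sigma_min A" by (simp add: singular_values_def)
  have le: "sigma_min A \<le> sqrt m"
    unfolding sigma_min_def using finite_singular_values[OF A] mem by (rule Min_le)
  show "sigma_min A * euclid_norm v \<le> euclid_norm (A *\<^sub>v v)" if v: "v \<in> carrier_vec n"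
  proof -
    have "sigma_min A * euclid_norm v \<le> sqrt m * euclid_norm v"
      using le by (intro mult_right_mono) auto
    also have "\<dots> = sqrt (m * (euclid_norm v)\<^sup>2)" by (simp add: real_sqrt_mult)
    also have "\<dots> \<le> euclid_norm (A *\<^sub>v v)" using m(3)[OF v] by (intro real_le_lsqrt) auto
    finally show ?thesis .
  qed
qed

section \<open>Relative perturbation of a determinant\<close>

lemma norm_prod_list_one_plus_minus_one:
  fixes as :: "complex list"
  assumes "\<And>a. a \<in> set as \<Longrightarrow> cmod a \<le> c"
  shows "cmod ((\<Prod>a\<leftarrow>as. 1 + a) - 1) \<le> (1 + c) ^ length as - 1"
  using assms
proof (induction as)
  case (Cons a as)
  define P where "P = (\<Prod>a\<leftarrow>as. 1 + a)"
  have IH: "cmod (P - 1) \<le> (1 + c) ^ length as - 1"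
    unfolding P_def using Cons by simp
  have a: "cmod a \<le> c" using Cons.prems by simp
  have P: "cmod P \<le> (1 + c) ^ length as"
    using norm_triangle_ineq[of "P - 1" 1] IH by simp
  have "cmod ((1 + a) * P - 1) = cmod ((P - 1) + a * P)"
    by (simp add: algebra_simps)
  also have "\<dots> \<le> cmod (P - 1) + cmod a * cmod P"
    using norm_triangle_ineq[of "P - 1" "a * P"] by (simp add: norm_mult)
  also have "cmod a * cmod P \<le> c * (1 + c) ^ length as"
    using a P order_trans[OF norm_ge_zero a] by (intro mult_mono) auto
  finally show ?case
    using IH by (simp add: P_def algebra_simps)
qed simp

text \<open>Up to the sign \<open>(- 1)\<^sup>n\<close>, \<open>det (1 + E)\<close> is the value of the characteristic polynomial at
  \<open>- 1\<close>, which splits over \<open>\<complex>\<close>; only the moduli of the eigenvalues matter.\<close>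

lemma norm_det_one_plus_minus_one:
  assumes E: "E \<in> carrier_mat n n" and c: "\<And>a. eigenvalue E a \<Longrightarrow> cmod a \<le> c"
  shows "cmod (Determinant.det (1\<^sub>m n + E) - 1) \<le> (1 + c) ^ n - 1"
proof -
  obtain as where as: "char_poly E = (\<Prod>a\<leftarrow>as. [:- a, 1:])" "length as = n"
    using char_poly_factorized[OF E] by blast
  have "- char_matrix E (- 1) = (- 1) \<cdot>\<^sub>m (1\<^sub>m n + E)"
    using E by (intro eq_matI) (auto simp: char_matrix_def)
  then have "poly (char_poly E) (- 1) = (- 1) ^ n * Determinant.det (1\<^sub>m n + E)"
    using E by (simp add: char_poly_matrix[OF E])
  also have "poly (char_poly E) (- 1) = (\<Prod>a\<leftarrow>as. - 1 * (1 + a))"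
    by (simp add: as poly_prod_list o_def minus_diff_commute)
  also have "\<dots> = (- 1) ^ n * (\<Prod>a\<leftarrow>as. 1 + a)"
    unfolding as(2)[symmetric] by (induction as) (simp_all add: algebra_simps)
  finally have "Determinant.det (1\<^sub>m n + E) = (\<Prod>a\<leftarrow>as. 1 + a)"
    by simp
  moreover have "cmod a \<le> c" if "a \<in> set as" for a
  proof (rule c)
    have "poly (char_poly E) a = 0"
      using that by (auto simp: as poly_prod_list prod_list_zero_iff)
    then show "eigenvalue E a" using eigenvalue_root_char_poly[OF E] by simp
  qed
  ultimately show ?thesis
    using norm_prod_list_one_plus_minus_one[of as c] as(2) by simp
qed

text \<open>Multiplicativity turns \<open>det (A + D) - det A\<close> into \<open>det A * (det (1 + E) - 1)\<close> with
  \<open>E = A\<^sup>-\<^sup>1 D\<close>, and \<open>2 powr (1 / n)\<close> is the value of \<open>1 + c\<close> at which \<open>(1 + c)\<^sup>n - 1\<close> reaches \<open>1\<close>.\<close>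

lemma norm_det_perturbation_less:
  assumes A: "A \<in> carrier_mat n n" and D: "D \<in> carrier_mat n n" and n: "0 < n"
    and d: "Determinant.det A \<noteq> 0"
    and c: "\<And>a. eigenvalue (mat_inv A * D) a \<Longrightarrow> cmod a \<le> c"
    and c0: "0 \<le> c" and c2: "c < 2 powr (1 / real n) - 1"
  shows "cmod (Determinant.det (A + D) - Determinant.det A) < cmod (Determinant.det A)"
proof -
  note inv = mat_inv_inverse[OF A d]
  define E where "E = mat_inv A * D"
  have E: "E \<in> carrier_mat n n" unfolding E_def using inv(1) D by (rule mult_carrier_mat)
  have "A * E = (A * mat_inv A) * D"
    unfolding E_def using A inv(1) D by (rule assoc_mult_mat[symmetric])
  then have AE: "A * E = D" using inv(2) D by simp
  have "A + D = A * (1\<^sub>m n + E)"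
    using mult_add_distrib_mat[OF A one_carrier_mat E] A AE by simp
  then have "Determinant.det (A + D) = Determinant.det A * Determinant.det (1\<^sub>m n + E)"
    using det_mult[of A n "1\<^sub>m n + E"] A E by simp
  then have "cmod (Determinant.det (A + D) - Determinant.det A)
      = cmod (Determinant.det A) * cmod (Determinant.det (1\<^sub>m n + E) - 1)"
    by (simp add: norm_mult[symmetric] right_diff_distrib)
  also have "\<dots> < cmod (Determinant.det A) * 1"
  proof (rule mult_strict_left_mono)
    have "(1 + c) ^ n < (2 powr (1 / real n)) ^ n"
      using c0 c2 n by (intro power_strict_mono) auto
    also have "\<dots> = 2" using n by (simp add: powr_power)
    finally show "cmod (Determinant.det (1\<^sub>m n + E) - 1) < 1"
      using norm_det_one_plus_minus_one[OF E c[folded E_def]] by linarith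
  qed (use d in simp)
  finally show ?thesis by simp
qed

text \<open>From \<open>A\<^sup>-\<^sup>1 D v = a v\<close> follows \<open>D v = a A v\<close>, and \<open>\<sigma>\<^sub>m\<^sub>i\<^sub>n\<close> bounds \<open>\<parallel>A v\<parallel>\<close>
  from below while \<open>K\<close> bounds \<open>\<parallel>D v\<parallel>\<close> from above.\<close>

lemma eigenvalue_inverse_mult_sigma_min_le:
  assumes A: "A \<in> carrier_mat n n" and D: "D \<in> carrier_mat n n" and n: "0 < n"
    and d: "Determinant.det A \<noteq> 0"
    and K: "\<And>v. v \<in> carrier_vec n \<Longrightarrow> euclid_norm (D *\<^sub>v v) \<le> K * euclid_norm v"
    and a: "eigenvalue (mat_inv A * D) a"
  shows "cmod a * sigma_min A \<le> K"
proof -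
  note inv = mat_inv_inverse[OF A d]
  have E: "mat_inv A * D \<in> carrier_mat n n" using inv(1) D by (rule mult_carrier_mat)
  obtain v where v: "v \<in> carrier_vec n" "v \<noteq> 0\<^sub>v n" "(mat_inv A * D) *\<^sub>v v = a \<cdot>\<^sub>v v"
    using a E unfolding eigenvalue_def eigenvector_def by auto
  have Dv: "D *\<^sub>v v \<in> carrier_vec n" using D v(1) by (rule mult_mat_vec_carrier)
  have "D *\<^sub>v v = (A * mat_inv A) *\<^sub>v (D *\<^sub>v v)" using inv(2) Dv by simp
  also have "\<dots> = A *\<^sub>v (mat_inv A *\<^sub>v (D *\<^sub>v v))" using A inv(1) Dv by (rule assoc_mult_mat_vec)
  also have "mat_inv A *\<^sub>v (D *\<^sub>v v) = a \<cdot>\<^sub>v v"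
    using assoc_mult_mat_vec[OF inv(1) D v(1)] v(3) by simp
  also have "A *\<^sub>v (a \<cdot>\<^sub>v v) = a \<cdot>\<^sub>v (A *\<^sub>v v)" using A v(1) by (rule mult_mat_vec)
  finally have "cmod a * euclid_norm (A *\<^sub>v v) = euclid_norm (D *\<^sub>v v)"
    by (simp add: euclid_norm_smult)
  then have "cmod a * euclid_norm (A *\<^sub>v v) \<le> K * euclid_norm v"
    using K[OF v(1)] by simp
  moreover have "cmod a * (sigma_min A * euclid_norm v) \<le> cmod a * euclid_norm (A *\<^sub>v v)"
    using sigma_min_mult_le[OF A n v(1)] by (intro mult_left_mono) auto
  ultimately have "(cmod a * sigma_min A) * euclid_norm v \<le> K * euclid_norm v"
    by (simp add: mult.assoc)
  moreover have "0 < euclid_norm v"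
    using v(1,2) euclid_norm_eq_0_iff[OF v(1)] euclid_norm_nonneg[of v] by linarith
  ultimately show ?thesis by (rule mult_right_le_imp_le)
qed

lemma euclid_norm_affine_mult_le:
  assumes D: "D1 \<in> carrier_mat n m" "D0 \<in> carrier_mat n m" and v: "v \<in> carrier_vec m"
  shows "euclid_norm ((D1 - z \<cdot>\<^sub>m D0) *\<^sub>v v)
      \<le> (spectral_norm D1 + cmod z * spectral_norm D0) * euclid_norm v"
proof -
  have "D1 - z \<cdot>\<^sub>m D0 = D1 + (- z) \<cdot>\<^sub>m D0"
    using D by (intro eq_matI) auto
  then have "(D1 - z \<cdot>\<^sub>m D0) *\<^sub>v v = D1 *\<^sub>v v + (- z) \<cdot>\<^sub>v (D0 *\<^sub>v v)"
    using add_mult_distrib_mat_vec[OF D(1) _ v, of "(- z) \<cdot>\<^sub>m D0"] D(2)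
    by (simp add: smult_mat_mult_vec[OF D(2) v])
  also have "euclid_norm \<dots> \<le> euclid_norm (D1 *\<^sub>v v) + cmod z * euclid_norm (D0 *\<^sub>v v)"
    using euclid_norm_triangle[of "D1 *\<^sub>v v" n "(- z) \<cdot>\<^sub>v (D0 *\<^sub>v v)"] D v
    by (simp add: euclid_norm_smult)
  also have "\<dots> \<le> spectral_norm D1 * euclid_norm v + cmod z * (spectral_norm D0 * euclid_norm v)"
    using euclid_norm_mult_le[OF D(1) v] euclid_norm_mult_le[OF D(2) v]
    by (intro add_mono mult_left_mono) auto
  finally show ?thesis by (simp add: algebra_simps)
qed

section \<open>Matrix pencils\<close>

lemma pencil_carrier:
  assumes "M1 \<in> carrier_mat n m" "M0 \<in> carrier_mat n m"
  shows "pencil M1 M0 z \<in> carrier_mat n m"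
  using assms unfolding pencil_def by (intro minus_carrier_mat) simp

lemma pencil_add:
  assumes "M1 \<in> carrier_mat n m" "M0 \<in> carrier_mat n m" "D1 \<in> carrier_mat n m" "D0 \<in> carrier_mat n m"
  shows "pencil (M1 + D1) (M0 + D0) z = pencil M1 M0 z + (D1 - z \<cdot>\<^sub>m D0)"
  unfolding pencil_def using assms by (intro eq_matI) (auto simp: algebra_simps)

lemma det_pencil_eq_poly:
  assumes "M1 \<in> carrier_mat n n" "M0 \<in> carrier_mat n n"
  obtains p where "\<And>z. Determinant.det (pencil M1 M0 z) = poly p z"
proof -
  define P where "P = Matrix.mat n n (\<lambda>ij. [: M1 $$ ij, - M0 $$ ij :])"
  have "poly (Determinant.det P) z = Determinant.det (pencil M1 M0 z)" for z
    by (rule poly_det_cong[of _ n]) (use assms in \<open>auto simp: P_def pencil_def\<close>)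
  then show ?thesis using that by metis
qed

text \<open>By Cramer's rule an entry of the inverse is a cofactor divided by the determinant.  Deleting a
  row and a column of a pencil gives a pencil, so both are polynomials in \<open>z\<close>.\<close>

lemma continuous_on_mat_inv_pencil:
  assumes M: "M1 \<in> carrier_mat n n" "M0 \<in> carrier_mat n n"
    and d: "\<And>z. z \<in> S \<Longrightarrow> Determinant.det (pencil M1 M0 z) \<noteq> 0"
    and ij: "i < n" "j < n"
  shows "continuous_on S (\<lambda>z. mat_inv (pencil M1 M0 z) $$ (i,j))"
proof -
  obtain p where p: "\<And>z. Determinant.det (pencil M1 M0 z) = poly p z"
    using det_pencil_eq_poly[OF M] by blast
  obtain c where c: "\<And>z. Determinant.det (pencil (mat_delete M1 j i) (mat_delete M0 j i) z) = poly c z"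
    using det_pencil_eq_poly[of "mat_delete M1 j i" "n - 1" "mat_delete M0 j i"]
      mat_delete_carrier[OF M(1)] mat_delete_carrier[OF M(2)] by blast
  have "mat_inv (pencil M1 M0 z) $$ (i,j) = (- 1) ^ (j + i) * poly c z / poly p z" if "z \<in> S" for z
  proof -
    have P: "pencil M1 M0 z \<in> carrier_mat n n" using M by (rule pencil_carrier)
    have "mat_delete (pencil M1 M0 z) j i = pencil (mat_delete M1 j i) (mat_delete M0 j i) z"
      using M ij by (intro eq_matI) (auto simp: pencil_def mat_delete_def)
    then have "adj_mat (pencil M1 M0 z) $$ (i,j) = (- 1) ^ (j + i) * poly c z"
      using P ij by (simp add: adj_mat_def cofactor_def c)
    moreover have "(Determinant.det (pencil M1 M0 z) \<cdot>\<^sub>m mat_inv (pencil M1 M0 z)) $$ (i,j)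
        = poly p z * mat_inv (pencil M1 M0 z) $$ (i,j)"
      using mat_inv_inverse(1)[OF P d[OF that]] ij by (simp add: p)
    ultimately show ?thesis
      using det_smult_mat_inv[OF P d[OF that]] d[OF that] by (simp add: p field_simps)
  qed
  moreover have "continuous_on S (\<lambda>z. (- 1) ^ (j + i) * poly c z / poly p z)"
    using d by (intro continuous_intros) (auto simp: p)
  ultimately show ?thesis by (simp cong: continuous_on_cong)
qed

text \<open>A supremum of reals bounds its family only when the family is bounded above; here the spectral
  norm is dominated by the sum of the moduli of the entries, which is continuous in \<open>z\<close>.\<close>

lemma bdd_above_spectral_norm_inverse_pencil:
  assumes M: "M1 \<in> carrier_mat n n" "M0 \<in> carrier_mat n n"
    and D: "D1 \<in> carrier_mat n n" "D0 \<in> carrier_mat n n"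
    and n: "0 < n" and S: "compact S"
    and d: "\<And>z. z \<in> S \<Longrightarrow> Determinant.det (pencil M1 M0 z) \<noteq> 0"
  shows "bdd_above ((\<lambda>z. spectral_norm (mat_inv (pencil M1 M0 z) * (D1 - z \<cdot>\<^sub>m D0))) ` S)"
proof -
  define e where "e z i j = (\<Sum>k<n. mat_inv (pencil M1 M0 z) $$ (i,k) * (D1 $$ (k,j) - z * D0 $$ (k,j)))"
    for z i j
  define F where "F z = (\<Sum>i<n. \<Sum>j<n. cmod (e z i j))" for z
  have "continuous_on S F"
    unfolding F_def e_def
    by (intro continuous_intros continuous_on_mat_inv_pencil[OF M d]) auto
  then have "bdd_above (F ` S)"
    using S by (intro bounded_imp_bdd_above compact_imp_bounded compact_continuous_image)
  then obtain K where K: "\<And>z. z \<in> S \<Longrightarrow> F z \<le> K" by (auto simp: bdd_above_def)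
  show ?thesis
  proof (rule bdd_aboveI2)
    fix z assume z: "z \<in> S"
    have I: "mat_inv (pencil M1 M0 z) \<in> carrier_mat n n"
      using mat_inv_inverse(1)[OF pencil_carrier[OF M] d[OF z]] .
    have DD: "D1 - z \<cdot>\<^sub>m D0 \<in> carrier_mat n n" using D(2) by (intro minus_carrier_mat) simp
    have "spectral_norm (mat_inv (pencil M1 M0 z) * (D1 - z \<cdot>\<^sub>m D0))
        \<le> (\<Sum>i<n. \<Sum>j<n. cmod ((mat_inv (pencil M1 M0 z) * (D1 - z \<cdot>\<^sub>m D0)) $$ (i,j)))"
      using spectral_norm_le_entries[OF mult_carrier_mat[OF I DD] n] .
    also have "\<dots> = F z"
      unfolding F_def e_def using I D
      by (simp add: scalar_prod_def atLeast0LessThan)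
    finally show "spectral_norm (mat_inv (pencil M1 M0 z) * (D1 - z \<cdot>\<^sub>m D0)) \<le> K"
      using K[OF z] by simp
  qed
qed

section \<open>The Hankel pencil of an exponential sum\<close>

text \<open>A kernel vector is the coefficient vector of a polynomial of degree below \<open>n\<close> that vanishes at
  the \<open>n\<close> distinct nodes.\<close>

lemma det_vandermonde_nonzero:
  fixes x :: "nat \<Rightarrow> 'a::field"
  assumes inj: "inj_on x {..<n}"
  shows "Determinant.det (Matrix.mat n n (\<lambda>(k, i). x k ^ i)) \<noteq> 0"
proof
  let ?V = "Matrix.mat n n (\<lambda>(k, i). x k ^ i)"
  assume "Determinant.det ?V = 0"
  then obtain v where v: "v \<in> carrier_vec n" "v \<noteq> 0\<^sub>v n" "?V *\<^sub>v v = 0\<^sub>v n"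
    using det_0_iff_vec_prod_zero[of ?V n] by auto
  define p where "p = (\<Sum>i<n. Polynomial.monom (vec_index v i) i)"
  have coeff: "Polynomial.coeff p i = vec_index v i" if "i < n" for i
    using that by (simp add: p_def Polynomial.coeff_sum)
  have root: "poly p (x k) = 0" if "k < n" for k
  proof -
    have "vec_index (?V *\<^sub>v v) k = 0" using v(3) that by simp
    then show ?thesis
      using that v(1) by (simp add: p_def poly_sum poly_monom scalar_prod_def atLeast0LessThan mult.commute)
  qed
  obtain i where i: "i < n" "vec_index v i \<noteq> 0"
    using v(1,2) by (metis carrier_vecD eq_vecI index_zero_vec)
  then have p0: "p \<noteq> 0" using coeff by fastforce
  have "n = card (x ` {..<n})" using inj by (simp add: card_image)
  also have "\<dots> \<le> card {z. poly p z = 0}"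
    using root p0 by (intro card_mono poly_roots_finite) auto
  also have "\<dots> \<le> degree p" using p0 by (rule poly_roots_degree)
  also have "\<dots> < n"
  proof -
    have "degree p \<le> n - 1" unfolding p_def
      by (intro degree_sum_le) (auto intro: order_trans[OF degree_monom_le])
    then show ?thesis using i by linarith
  qed
  finally show False by simp
qed

lemma hankel_carrier [simp]: "hankel r q \<alpha> w s \<in> carrier_mat r r"
  by (simp add: hankel_def)

text \<open>The pencil has entries \<open>\<Sum>k. w k * (\<rho> k - z) * \<rho> k ^ (i + j)\<close>, which is the congruence
  \<open>V\<^sup>T D(z) V\<close> of a diagonal matrix by the Vandermonde matrix of the nodes.\<close>

lemma det_hankel_pencil:
  assumes w: "\<And>k. k \<in> {1..r} \<Longrightarrow> w k \<noteq> 0" and inj: "inj_on (node q \<alpha>) {1..r}"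
  obtains C where "C \<noteq> 0"
    "\<And>z. Determinant.det (pencil (hankel r q \<alpha> w 1) (hankel r q \<alpha> w 0) z)
        = C * (\<Prod>k\<in>{1..r}. node q \<alpha> k - z)"
proof -
  let ?x = "\<lambda>k. node q \<alpha> (Suc k)"
  define V where "V = Matrix.mat r r (\<lambda>(k, i). ?x k ^ i)"
  have V: "V \<in> carrier_mat r r" by (simp add: V_def)
  have VT: "transpose_mat V \<in> carrier_mat r r" using V by simp
  have dV: "Determinant.det V \<noteq> 0" unfolding V_def
  proof (intro det_vandermonde_nonzero inj_onI)
    fix a b assume "a \<in> {..<r}" "b \<in> {..<r}" "?x a = ?x b"
    then show "a = b" using inj_onD[OF inj, of "Suc a" "Suc b"] by simp
  qed
  define W where "W = (\<Prod>k<r. w (Suc k))"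
  have W: "W \<noteq> 0" using w by (simp add: W_def)
  have det: "Determinant.det (pencil (hankel r q \<alpha> w 1) (hankel r q \<alpha> w 0) z)
      = ((Determinant.det V)\<^sup>2 * W) * (\<Prod>k\<in>{1..r}. node q \<alpha> k - z)" for z
  proof -
    define D where "D = mat_diag r (\<lambda>k. w (Suc k) * (?x k - z))"
    have D: "D \<in> carrier_mat r r" by (simp add: D_def)
    have "pencil (hankel r q \<alpha> w 1) (hankel r q \<alpha> w 0) z = transpose_mat V * (D * V)"
    proof (rule eq_matI)
      have DV: "D * V = Matrix.mat r r (\<lambda>(k, j). w (Suc k) * (?x k - z) * V $$ (k, j))"
        unfolding D_def by (rule mat_diag_mult_left[OF V])
      fix i j assume "i < dim_row (transpose_mat V * (D * V))" "j < dim_col (transpose_mat V * (D * V))"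
      then have ij: "i < r" "j < r" using V by auto
      have "(transpose_mat V * (D * V)) $$ (i,j)
          = (\<Sum>k<r. ?x k ^ i * (w (Suc k) * (?x k - z) * ?x k ^ j))"
        unfolding DV using ij by (simp add: scalar_prod_def V_def atLeast0LessThan)
      also have "\<dots> = (\<Sum>k<r. w (Suc k) * ?x k ^ (i + j + 1)) - z * (\<Sum>k<r. w (Suc k) * ?x k ^ (i + j))"
        unfolding sum_distrib_left sum_subtractf[symmetric]
        by (intro sum.cong) (simp_all add: power_add algebra_simps)
      also have "\<dots> = pencil (hankel r q \<alpha> w 1) (hankel r q \<alpha> w 0) z $$ (i,j)"
        using ij by (simp add: pencil_def hankel_def moment_def sum.atLeast1_atMost_eq)
      finally show "pencil (hankel r q \<alpha> w 1) (hankel r q \<alpha> w 0) z $$ (i,j)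
          = (transpose_mat V * (D * V)) $$ (i,j)" ..
    qed (use V in \<open>auto simp: pencil_def hankel_def\<close>)
    then have "Determinant.det (pencil (hankel r q \<alpha> w 1) (hankel r q \<alpha> w 0) z)
        = Determinant.det V * (Determinant.det D * Determinant.det V)"
      using det_mult[OF VT, of "D * V"] det_mult[OF D V] det_transpose[OF V] D V by simp
    also have "Determinant.det D = (\<Prod>k<r. w (Suc k) * (?x k - z))"
    proof -
      have "Determinant.det D = prod_list (diag_mat D)"
        by (rule det_upper_triangular[OF _ D]) (auto simp: D_def mat_diag_def)
      also have "diag_mat D = map (\<lambda>k. w (Suc k) * (?x k - z)) [0..<r]"
        unfolding diag_mat_def by (auto simp: D_def mat_diag_def)
      finally show ?thesis
        by (simp add: atLeast0LessThan flip: prod.distinct_set_conv_list)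
    qed
    also have "\<dots> = W * (\<Prod>k\<in>{1..r}. node q \<alpha> k - z)"
      by (simp add: W_def prod.distrib prod.atLeast1_atMost_eq)
    finally show ?thesis by (simp add: power2_eq_square mult_ac)
  qed
  show thesis
    by (rule that[of "(Determinant.det V)\<^sup>2 * W"]) (use dV W det in auto)
qed

section \<open>A perturbed simple zero\<close>

lemma zorder_poly_pos:
  assumes "p \<noteq> 0" "poly p z = 0"
  shows "0 < zorder (poly p) z"
proof -
  have "eventually (\<lambda>w. poly p w \<noteq> 0) (at z)"
    using islimpt_finite[OF poly_roots_finite[OF assms(1)], of z]
    by (simp add: islimpt_iff_eventually)
  then have "frequently (\<lambda>w. poly p w \<noteq> 0) (at z)"
    by (rule eventually_frequently[rotated]) simp
  then show ?thesis
    using assms(2) zorder_pos_iff[of "poly p" UNIV z] by (simp add: poly_holomorphic_on)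
qed

text \<open>Around the circle every zero inside has winding number \<open>1\<close> and every zero outside has \<open>0\<close>,
  so Rouche's theorem equates the sums of the orders of the zeros in the disk.  For \<open>h\<close> this sum is
  \<open>1\<close>, and as every zero has order at least \<open>1\<close>, there is one zero, of order \<open>1\<close>.\<close>

lemma Rouche_poly_simple_zero:
  assumes d: "0 < d"
    and g: "\<And>z. cmod (z - a) \<le> d \<Longrightarrow> poly g z \<noteq> 0"
    and less: "\<And>z. cmod (z - a) = d \<Longrightarrow>
      cmod (poly h z - poly ([:- a, 1:] * g) z) < cmod (poly ([:- a, 1:] * g) z)"
  obtains b where "{z. cmod (z - a) < d \<and> poly h z = 0} = {b}" "zorder (poly h) b = 1"
proof -
  define f where "f = [:- a, 1:] * g"
  have less: "cmod (poly h z - poly f z) < cmod (poly f z)" if "cmod (z - a) = d" for z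
    using less[OF that] unfolding f_def .
  have "g \<noteq> 0" using g[of a] d by auto
  then have f0: "f \<noteq> 0" unfolding f_def by (simp only: mult_eq_0_iff) simp
  have "cmod ((a + of_real d) - a) = d" using d by simp
  from less[OF this] have h0: "h \<noteq> 0" by auto
  define Z where "Z p = {z. poly p z = 0}" for p :: "complex poly"
  have fin: "finite (Z p)" if "p \<noteq> 0" for p
    unfolding Z_def using that by (rule poly_roots_finite)
  let ?\<gamma> = "circlepath a d"
  have count: "(\<Sum>p\<in>Z q. winding_number ?\<gamma> p * zorder (poly q) p)
      = of_int (\<Sum>p\<in>{z. cmod (z - a) < d \<and> poly q z = 0}. zorder (poly q) p)"
    if q0: "q \<noteq> 0" and off: "\<And>z. cmod (z - a) = d \<Longrightarrow> poly q z \<noteq> 0" for q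
  proof -
    have "(\<Sum>p\<in>Z q. winding_number ?\<gamma> p * zorder (poly q) p)
        = (\<Sum>p\<in>{z. cmod (z - a) < d \<and> poly q z = 0}. of_int (zorder (poly q) p))"
    proof (rule sum.mono_neutral_cong_right[OF fin[OF q0]])
      show "\<forall>p\<in>Z q - {z. cmod (z - a) < d \<and> poly q z = 0}.
          winding_number ?\<gamma> p * of_int (zorder (poly q) p) = 0"
      proof
        fix p assume "p \<in> Z q - {z. cmod (z - a) < d \<and> poly q z = 0}"
        then have "d < cmod (p - a)" using off[of p] by (auto simp: Z_def not_less le_less)
        then have "winding_number ?\<gamma> p = 0"
          using d by (intro winding_number_zero_outside[where s = "cball a d"])
            (auto simp: dist_norm norm_minus_commute)
        then show "winding_number ?\<gamma> p * of_int (zorder (poly q) p) = 0" by simp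
      qed
    qed (auto simp: Z_def winding_number_circlepath)
    then show ?thesis by simp
  qed
  have off_f: "poly f z \<noteq> 0" if "cmod (z - a) = d" for z
    using less[OF that] by auto
  have off_h: "poly h z \<noteq> 0" if "cmod (z - a) = d" for z
    using less[OF that] by auto
  have sum_eq: "(\<Sum>p\<in>Z h. winding_number ?\<gamma> p * zorder (poly h) p)
      = (\<Sum>p\<in>Z f. winding_number ?\<gamma> p * zorder (poly f) p)"
  proof -
    have "(\<Sum>p\<in>{p\<in>UNIV. poly f p + poly (h - f) p = 0}.
          winding_number ?\<gamma> p * zorder (\<lambda>p. poly f p + poly (h - f) p) p)
        = (\<Sum>p\<in>{p\<in>UNIV. poly f p = 0}. winding_number ?\<gamma> p * zorder (poly f) p)"
    proof (rule Rouche_theorem)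
      show "finite {p \<in> UNIV. poly f p + poly (h - f) p = 0}"
        using fin[OF h0] by (simp add: Z_def)
      show "finite {p \<in> UNIV. poly f p = 0}"
        using fin[OF f0] by (simp add: Z_def)
      show "\<forall>z\<in>path_image ?\<gamma>. cmod (poly (h - f) z) < cmod (poly f z)"
        using less d by (auto simp: dist_norm norm_minus_commute)
    qed (auto intro!: holomorphic_intros)
    then show ?thesis by (simp add: Z_def)
  qed
  have zf: "zorder (poly f) a = 1"
    by (rule zorder_eqI[of UNIV _ "poly g"])
      (use g[of a] d in \<open>auto simp: f_def algebra_simps intro!: poly_holomorphic_on\<close>)
  have Zf: "{z. cmod (z - a) < d \<and> poly f z = 0} = {a}"
    using g d by (force simp: f_def)
  define R where "R = {z. cmod (z - a) < d \<and> poly h z = 0}"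
  have finR: "finite R"
    using fin[OF h0] by (rule finite_subset[rotated]) (auto simp: R_def Z_def)
  have "complex_of_int (\<Sum>p\<in>R. zorder (poly h) p)
      = (\<Sum>p\<in>Z h. winding_number ?\<gamma> p * zorder (poly h) p)"
    unfolding R_def using off_h by (intro count[OF h0, symmetric]) auto
  also note sum_eq
  also have "(\<Sum>p\<in>Z f. winding_number ?\<gamma> p * zorder (poly f) p)
      = of_int (\<Sum>p\<in>{a}. zorder (poly f) p)"
    unfolding Zf[symmetric] using off_f by (intro count[OF f0]) auto
  finally have "complex_of_int (\<Sum>p\<in>R. zorder (poly h) p) = complex_of_int 1"
    by (simp add: zf)
  then have total: "(\<Sum>p\<in>R. zorder (poly h) p) = 1"
    by (simp only: of_int_eq_iff)
  have pos: "1 \<le> zorder (poly h) p" if "p \<in> R" for p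
    using zorder_poly_pos[OF h0, of p] that by (simp add: R_def)
  have "R \<noteq> {}" using total by auto
  then obtain b where b: "b \<in> R" by blast
  have "(\<Sum>p\<in>R. zorder (poly h) p) = zorder (poly h) b + (\<Sum>p\<in>R - {b}. zorder (poly h) p)"
    using finR b by (rule sum.remove)
  moreover have "int (card (R - {b})) \<le> (\<Sum>p\<in>R - {b}. zorder (poly h) p)"
    using sum_mono[of "R - {b}" "\<lambda>_. 1" "zorder (poly h)"] pos by simp
  ultimately have "zorder (poly h) b = 1" "card (R - {b}) = 0"
    using pos[OF b] total by linarith+
  moreover from this have "R - {b} = {}" using finR by (simp only: card_0_eq finite_Diff)
  then have "R = {b}" using b by blast
  ultimately show thesis using that unfolding R_def by blast
qed

section \<open>Logarithms of nearby numbers\<close>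

text \<open>On the disk of radius \<open>\<bar>u\<bar>\<close> about \<open>1\<close> the derivative of the logarithm is at most
  \<open>1 / (1 - \<bar>u\<bar>)\<close>.\<close>

lemma norm_Ln_one_plus_le:
  assumes "cmod u < 1"
  shows "cmod (Ln (1 + u)) \<le> cmod u / (1 - cmod u)"
proof -
  have "cmod (Ln (1 + u) - Ln 1) \<le> 1 / (1 - cmod u) * cmod ((1 + u) - 1)"
  proof (rule field_differentiable_bound[of "cball 1 (cmod u)" Ln inverse])
    fix z :: complex assume "z \<in> cball 1 (cmod u)"
    then have *: "cmod (1 - z) \<le> cmod u" by (simp add: dist_norm)
    have "z \<notin> \<real>\<^sub>\<le>\<^sub>0"
      using * assms complex_Re_le_cmod[of "1 - z"] by (auto simp: complex_nonpos_Reals_iff)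
    then show "(Ln has_field_derivative inverse z) (at z within cball 1 (cmod u))"
      by (rule has_field_derivative_Ln[THEN has_field_derivative_at_within])
    have "1 - cmod u \<le> cmod z"
      using * norm_triangle_ineq[of "1 - z" z] by simp
    then show "cmod (inverse z) \<le> 1 / (1 - cmod u)"
      using assms by (simp add: norm_divide inverse_eq_divide frac_le)
  qed (auto simp: dist_norm)
  then show ?thesis by simp
qed

text \<open>\<open>(\<beta> - \<alpha>) * ln q\<close> is one of the logarithms of \<open>q\<^sup>\<beta> / q\<^sup>\<alpha>\<close>; the integer \<open>k\<close> counts how many
  periods it lies away from the principal one, whose size is controlled by
  \<open>norm_Ln_one_plus_le\<close>.\<close>

lemma exponent_error_bound:
  fixes q d :: real and \<alpha> \<beta> :: complex
  assumes q: "0 < q" "q < 1"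
    and close: "cmod (complex_of_real q powr \<beta> - complex_of_real q powr \<alpha>) < d"
    and d: "d < cmod (complex_of_real q powr \<alpha>)"
  shows "\<exists>k::int. cmod (\<beta> - \<alpha> - 2 * complex_of_real pi * \<i> * of_int k / complex_of_real (ln q))
      \<le> d / (\<bar>ln q\<bar> * (cmod (complex_of_real q powr \<alpha>) - d))"
proof -
  define L where "L = complex_of_real (ln q)"
  define \<rho> where "\<rho> = complex_of_real q powr \<alpha>"
  have lnq: "ln q < 0" using q by simp
  then have L0: "L \<noteq> 0" by (simp add: L_def)
  have L: "Ln (complex_of_real q) = L" unfolding L_def using q(1) by (rule Ln_of_real)
  have powr: "complex_of_real q powr x = exp (x * L)" for x
    using q by (simp add: powr_def L)
  have r0: "0 < cmod \<rho>" by (simp add: \<rho>_def powr)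
  define u where "u = (complex_of_real q powr \<beta> - \<rho>) / \<rho>"
  have u: "cmod u < d / cmod \<rho>"
    using close r0 unfolding u_def norm_divide \<rho>_def by (intro divide_strict_right_mono)
  have d1: "d / cmod \<rho> < 1" using d r0 unfolding \<rho>_def by simp
  have "exp ((\<beta> - \<alpha>) * L) = 1 + u"
    using r0 unfolding u_def \<rho>_def powr
    by (simp add: left_diff_distrib exp_diff field_simps)
  moreover have "1 + u \<noteq> 0"
    using calculation by (metis exp_not_eq_zero)
  ultimately have "exp ((\<beta> - \<alpha>) * L) = exp (Ln (1 + u))" by simp
  then obtain k :: int where k: "(\<beta> - \<alpha>) * L = Ln (1 + u) + (of_int (2 * k) * pi) * \<i>"
    unfolding exp_eq by blast
  have "\<beta> - \<alpha> - 2 * complex_of_real pi * \<i> * of_int k / L = Ln (1 + u) / L"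
    using k L0 by (simp add: field_simps)
  then have "cmod (\<beta> - \<alpha> - 2 * complex_of_real pi * \<i> * of_int k / L) = cmod (Ln (1 + u)) / \<bar>ln q\<bar>"
    by (simp add: norm_divide L_def)
  also have "\<dots> \<le> (d / (cmod \<rho> - d)) / \<bar>ln q\<bar>"
  proof (rule divide_right_mono)
    have "cmod (Ln (1 + u)) \<le> cmod u / (1 - cmod u)"
      using u d1 by (intro norm_Ln_one_plus_le) simp
    also have "\<dots> \<le> (d / cmod \<rho>) / (1 - d / cmod \<rho>)"
      using u d1 order_trans[OF norm_ge_zero less_imp_le[OF u]] by (intro frac_le) auto
    also have "\<dots> = d / (cmod \<rho> - d)"
      using r0 d d1 unfolding \<rho>_def by (simp add: field_simps)
    finally show "cmod (Ln (1 + u)) \<le> d / (cmod \<rho> - d)" .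
  qed simp
  also have "\<dots> = d / (\<bar>ln q\<bar> * (cmod \<rho> - d))" by (simp add: mult.commute)
  finally show ?thesis unfolding L_def \<rho>_def by blast
qed

section \<open>The perturbed node\<close>

theorem corollary4p6:
  fixes r l :: nat and q d :: real and \<alpha> w :: "nat \<Rightarrow> complex"
    and \<Delta>0 \<Delta>1 :: "complex Matrix.mat"
  defines "\<rho> \<equiv> node q \<alpha> l"
    and "A \<equiv> pencil (hankel r q \<alpha> w 1) (hankel r q \<alpha> w 0)"
    and "A' \<equiv> pencil (hankel r q \<alpha> w 1 + \<Delta>1) (hankel r q \<alpha> w 0 + \<Delta>0)"
  defines "\<Psi> \<equiv> (\<lambda>z. Determinant.det (A z))"
    and "\<Psi>' \<equiv> (\<lambda>z. Determinant.det (A' z))"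
    and "\<Gamma> \<equiv> {z. cmod (z - \<rho>) = d}"
  assumes "r \<ge> 1" and "0 < q" and "q < 1"
    and "\<And>k. k \<in> {1..r} \<Longrightarrow> w k \<noteq> 0"
    and "inj_on (node q \<alpha>) {1..r}"
    and "\<Delta>0 \<in> carrier_mat r r" and "\<Delta>1 \<in> carrier_mat r r"
    and "l \<in> {1..r}"
    and "0 < d" and "ereal d < separation r q \<alpha> l"
    and "(SUP z\<in>\<Gamma>. cmod (\<Psi>' z - \<Psi> z)) < (INF z\<in>\<Gamma>. cmod (\<Psi> z))
       \<or> (SUP z\<in>\<Gamma>. spectral_norm (mat_inv (A z) * (\<Delta>1 - z \<cdot>\<^sub>m \<Delta>0))) < 2 powr (1 / real r) - 1
       \<or> spectral_norm \<Delta>1 + (SUP z\<in>\<Gamma>. cmod z) * spectral_norm \<Delta>0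
           < (2 powr (1 / real r) - 1) * (INF z\<in>\<Gamma>. sigma_min (A z))"
  shows "\<exists>\<rho>'. {z. cmod (z - \<rho>) < d \<and> \<Psi>' z = 0} = {\<rho>'}
           \<and> zorder \<Psi>' \<rho>' = 1
           \<and> cmod (\<rho>' - \<rho>) < d
           \<and> (d < cmod \<rho> \<longrightarrow>
               (\<forall>\<alpha>'. complex_of_real q powr \<alpha>' = \<rho>' \<longrightarrow>
                 (\<exists>k::int. cmod (\<alpha>' - \<alpha> l - 2 * complex_of_real pi * \<i> * of_int k / complex_of_real (ln q))
                    \<le> d / (\<bar>ln q\<bar> * (cmod \<rho> - d)))))"
proof -
  note q = \<open>0 < q\<close> \<open>q < 1\<close> and D = \<open>\<Delta>1 \<in> carrier_mat r r\<close> \<open>\<Delta>0 \<in> carrier_mat r r\<close>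
  note hyp = assms(17)
  have r: "0 < r" using \<open>r \<ge> 1\<close> by simp
  note H = hankel_carrier[of r q \<alpha> w 1] hankel_carrier[of r q \<alpha> w 0]
  have DD: "\<Delta>1 - z \<cdot>\<^sub>m \<Delta>0 \<in> carrier_mat r r" for z
    using D(2) by (intro minus_carrier_mat) simp
  have A: "A z \<in> carrier_mat r r" for z
    unfolding A_def using H by (rule pencil_carrier)
  have A': "A' z = A z + (\<Delta>1 - z \<cdot>\<^sub>m \<Delta>0)" for z
    unfolding A_def A'_def using H D by (rule pencil_add)

  obtain C where C: "C \<noteq> 0" and \<Psi>: "\<And>z. \<Psi> z = C * (\<Prod>k\<in>{1..r}. node q \<alpha> k - z)"
    using det_hankel_pencil[of r w q \<alpha>] assms(10,11) unfolding \<Psi>_def A_def by metis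
  (* The sign turns the factor rho - z of Psi into the monic z - rho. *)
  define g where "g = Polynomial.smult (- C) (\<Prod>k\<in>{1..r} - {l}. [:node q \<alpha> k, - 1:])"
  have \<Psi>_g: "\<Psi> z = poly ([:- \<rho>, 1:] * g) z" for z
  proof -
    have "(\<Prod>k\<in>{1..r}. node q \<alpha> k - z) = (\<rho> - z) * (\<Prod>k\<in>{1..r} - {l}. node q \<alpha> k - z)"
      unfolding \<rho>_def by (rule prod.remove[OF _ \<open>l \<in> {1..r}\<close>]) simp
    then show ?thesis
      by (simp only: \<Psi>) (simp add: g_def poly_prod algebra_simps)
  qed
  have sep: "d < cmod (\<rho> - node q \<alpha> k)" if "k \<in> {1..r} - {l}" for k
  proof -
    have "separation r q \<alpha> l \<le> ereal (cmod (\<rho> - node q \<alpha> k))"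
      unfolding separation_def \<rho>_def using that by (rule INF_lower)
    with \<open>ereal d < separation r q \<alpha> l\<close> show ?thesis
      by (metis ereal_less_eq(3) leD leI order.strict_trans2)
  qed
  have g: "poly g z \<noteq> 0" if "cmod (z - \<rho>) \<le> d" for z
    using sep that C by (fastforce simp: g_def poly_prod norm_minus_commute)
  have \<Gamma>: "\<Gamma> = sphere \<rho> d" by (auto simp: \<Gamma>_def sphere_def dist_norm norm_minus_commute)
  have compact: "compact \<Gamma>" unfolding \<Gamma> by simp
  have \<Psi>_nz: "\<Psi> z \<noteq> 0" if "z \<in> \<Gamma>" for z
    using that g[of z] \<open>0 < d\<close> by (auto simp: \<Psi>_g \<Gamma>_def algebra_simps)
  then have det_nz: "Determinant.det (A z) \<noteq> 0" if "z \<in> \<Gamma>" for z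
    using that by (simp add: \<Psi>_def)
  have HD: "hankel r q \<alpha> w 1 + \<Delta>1 \<in> carrier_mat r r" "hankel r q \<alpha> w 0 + \<Delta>0 \<in> carrier_mat r r"
    using D by simp_all
  obtain h where h: "\<Psi>' = poly h"
  proof (rule det_pencil_eq_poly[OF HD])
    fix p assume "\<And>z. Determinant.det (pencil (hankel r q \<alpha> w 1 + \<Delta>1) (hankel r q \<alpha> w 0 + \<Delta>0) z) = poly p z"
    then have "\<Psi>' = poly p" unfolding \<Psi>'_def A'_def by (rule ext)
    then show thesis by (rule that)
  qed

  have less: "cmod (\<Psi>' z - \<Psi> z) < cmod (\<Psi> z)" if z: "z \<in> \<Gamma>" for z
    using hyp
  proof (elim disjE)
    assume *: "(SUP z\<in>\<Gamma>. cmod (\<Psi>' z - \<Psi> z)) < (INF z\<in>\<Gamma>. cmod (\<Psi> z))"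
    have "continuous_on \<Gamma> (\<lambda>z. cmod (\<Psi>' z - \<Psi> z))"
      unfolding h \<Psi>_g by (intro continuous_intros)
    then have "bdd_above ((\<lambda>z. cmod (\<Psi>' z - \<Psi> z)) ` \<Gamma>)"
      using compact by (intro bounded_imp_bdd_above compact_imp_bounded compact_continuous_image)
    with z have "cmod (\<Psi>' z - \<Psi> z) \<le> (SUP z\<in>\<Gamma>. cmod (\<Psi>' z - \<Psi> z))"
      by (rule cSUP_upper)
    also note *
    also have "(INF z\<in>\<Gamma>. cmod (\<Psi> z)) \<le> cmod (\<Psi> z)"
      by (rule cINF_lower[OF _ z]) (rule bdd_belowI2[of _ 0], simp)
    finally show ?thesis .
  next
    assume *: "(SUP z\<in>\<Gamma>. spectral_norm (mat_inv (A z) * (\<Delta>1 - z \<cdot>\<^sub>m \<Delta>0))) < 2 powr (1 / real r) - 1"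
    let ?E = "\<lambda>z. mat_inv (A z) * (\<Delta>1 - z \<cdot>\<^sub>m \<Delta>0)"
    have E: "?E z \<in> carrier_mat r r"
      using mat_inv_inverse(1)[OF A det_nz[OF z]] DD by (rule mult_carrier_mat)
    have "bdd_above ((\<lambda>z. spectral_norm (?E z)) ` \<Gamma>)"
      unfolding A_def
      by (rule bdd_above_spectral_norm_inverse_pencil[OF H D r compact det_nz[unfolded A_def]])
    with z have "spectral_norm (?E z) \<le> (SUP z\<in>\<Gamma>. spectral_norm (?E z))"
      by (rule cSUP_upper)
    with * have "spectral_norm (?E z) < 2 powr (1 / real r) - 1" by linarith
    with norm_det_perturbation_less[OF A DD r det_nz[OF z] eigenvalue_norm_le_spectral_norm[OF E]
        spectral_norm_nonneg[OF E r]]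
    show ?thesis by (simp add: \<Psi>_def \<Psi>'_def A')
  next
    assume *: "spectral_norm \<Delta>1 + (SUP z\<in>\<Gamma>. cmod z) * spectral_norm \<Delta>0
           < (2 powr (1 / real r) - 1) * (INF z\<in>\<Gamma>. sigma_min (A z))"
    define K where "K = spectral_norm \<Delta>1 + cmod z * spectral_norm \<Delta>0"
    note nonneg = spectral_norm_nonneg[OF D(1) r] spectral_norm_nonneg[OF D(2) r]
    have pos: "0 < 2 powr (1 / real r) - 1" using powr_less_mono[of 0 "1 / real r" 2] r by simp
    have K0: "0 \<le> K" unfolding K_def using nonneg by simp
    have "continuous_on \<Gamma> cmod" by (intro continuous_intros)
    then have "bdd_above (cmod ` \<Gamma>)"
      using compact by (intro bounded_imp_bdd_above compact_imp_bounded compact_continuous_image)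
    with z have "cmod z \<le> (SUP z\<in>\<Gamma>. cmod z)" by (rule cSUP_upper)
    then have "K \<le> spectral_norm \<Delta>1 + (SUP z\<in>\<Gamma>. cmod z) * spectral_norm \<Delta>0"
      unfolding K_def using nonneg by (intro add_left_mono mult_right_mono) auto
    also note *
    also have "(2 powr (1 / real r) - 1) * (INF z\<in>\<Gamma>. sigma_min (A z))
        \<le> (2 powr (1 / real r) - 1) * sigma_min (A z)"
      using pos sigma_min_nonneg[OF A r] z
      by (intro mult_left_mono cINF_lower bdd_belowI2[of _ 0]) auto
    finally have K: "K < (2 powr (1 / real r) - 1) * sigma_min (A z)" .
    have "0 < (2 powr (1 / real r) - 1) * sigma_min (A z)" using K0 K by linarith
    then have s: "0 < sigma_min (A z)" using pos by (simp add: zero_less_mult_iff)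
    have "cmod a \<le> K / sigma_min (A z)" if "eigenvalue (mat_inv (A z) * (\<Delta>1 - z \<cdot>\<^sub>m \<Delta>0)) a" for a
      using eigenvalue_inverse_mult_sigma_min_le[OF A DD r det_nz[OF z] _ that, of K]
        euclid_norm_affine_mult_le[OF D] s
      by (simp add: K_def pos_le_divide_eq)
    moreover have "K / sigma_min (A z) < 2 powr (1 / real r) - 1"
      using K s by (simp add: pos_divide_less_eq)
    moreover have "0 \<le> K / sigma_min (A z)" using K0 s by simp
    ultimately show ?thesis
      using norm_det_perturbation_less[OF A DD r det_nz[OF z], where c = "K / sigma_min (A z)"]
      by (simp add: \<Psi>_def \<Psi>'_def A')
  qed

  obtain \<rho>' where \<rho>': "{z. cmod (z - \<rho>) < d \<and> \<Psi>' z = 0} = {\<rho>'}" "zorder \<Psi>' \<rho>' = 1"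
    using Rouche_poly_simple_zero[OF \<open>0 < d\<close> g, of \<rho> h] less
    unfolding h \<Psi>_g \<Gamma>_def by blast
  then have close: "cmod (\<rho>' - \<rho>) < d" by auto
  have "\<exists>k::int. cmod (\<alpha>' - \<alpha> l - 2 * complex_of_real pi * \<i> * of_int k / complex_of_real (ln q))
      \<le> d / (\<bar>ln q\<bar> * (cmod \<rho> - d))"
    if "d < cmod \<rho>" "complex_of_real q powr \<alpha>' = \<rho>'" for \<alpha>'
    using exponent_error_bound[OF q, of \<alpha>' "\<alpha> l" d] close that
    unfolding \<rho>_def node_def by simp
  with \<rho>' close show ?thesis by blast
qed

end
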